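(* Let $P(T)=T^d+a_{d-1}T^{d-1}+\cdots+a_1T\in\mathbb Z[T]$ with all $a_i\ge0$, and suppose that $P$ is separable of degree $d\ge2$. Let $U(P;X)$ be the set of points of $[1,X]^2\cap\mathbb Z^2$ that are not globally visible for the family $\phi_q(t)=(t,qP(t))$, $q\in\mathbb Q_{>0}$. Then, for every $\varepsilon>0$, $$\#U(P;X)\ll_{P,\varepsilon}X^{\frac32+\frac1{2d}+\varepsilon}.$$ In particular, the proportion of invisible points in $[1,X]^2$ is $O_{P,\varepsilon}\bigl(X^{-1/2+1/(2d)+\varepsilon}\bigr)$.
   Context: Every $(x,y)\in\mathbb Z_{\ge1}^2$ is $\phi_q(x)$ for the unique $q=y/P(x)\in\mathbb Q_{>0}$. It is globally visible if there is no real $s$ with $0<s<x$ and $\phi_q(s)\in\mathbb Z^2$; otherwise it is called (globally) invisible. Separable means having no repeated roots in $\mathbb C$. The notation $f(X)\ll_{P,\varepsilon}g(X)$ (equivalently $f=O_{P,\varepsilon}(g)$) means $|f(X)|\le C g(X)$ for all $X\ge1$ with $C$ depending only on $P$ and $\varepsilon$. *)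

theory Defs
  imports Complex_Main "HOL-Computational_Algebra.Polynomial"
begin

definition separable_poly :: "int poly \<Rightarrow> bool" where
  "separable_poly P \<longleftrightarrow> rsquarefree (map_poly of_int P :: complex poly)"

definition phi :: "int poly \<Rightarrow> rat \<Rightarrow> real \<Rightarrow> real \<times> real" where
  "phi P q t = (t, of_rat q * poly (map_poly of_int P) t)"

lemma phi_passes_through_iff:
  assumes "poly P x > 0"
  shows "phi P q (of_int x) = (of_int x, of_int y) \<longleftrightarrow> q = of_int y / of_int (poly P x)"
proof -
  have "poly (map_poly of_int P :: real poly) (of_int x) = of_int (poly P x)"
    by (induction P) (simp_all add: map_poly_pCons)
  then have "phi P q (of_int x) = (of_int x, of_int y)
      \<longleftrightarrow> of_rat (q * of_int (poly P x)) = (of_rat (of_int y) :: real)"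
    by (simp add: phi_def of_rat_mult)
  also have "\<dots> \<longleftrightarrow> q = of_int y / of_int (poly P x)"
    using assms by (simp only: of_rat_eq_iff) (simp add: field_simps)
  finally show ?thesis .
qed

text \<open>
  The rational \<open>y / P x\<close> is the unique parameter of the curve through \<open>(x, y)\<close>,
  by \<open>phi_passes_through_iff\<close>; it is positive for \<open>x, y \<ge> 1\<close> and the polynomials
  considered.
\<close>

definition globally_visible :: "int poly \<Rightarrow> int \<times> int \<Rightarrow> bool" where
  "globally_visible P = (\<lambda>(x, y).
     \<not> (\<exists>s::real. 0 < s \<and> s < of_int x \<and>
          phi P (of_int y / of_int (poly P x)) s \<in> \<int> \<times> \<int>))"

definition lattice_square :: "real \<Rightarrow> (int \<times> int) set" where
  "lattice_square X = {(x, y). 1 \<le> x \<and> of_int x \<le> X \<and> 1 \<le> y \<and> of_int y \<le> X}"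

definition invisible_points :: "int poly \<Rightarrow> real \<Rightarrow> (int \<times> int) set" where
  "invisible_points P X = {p \<in> lattice_square X. \<not> globally_visible P p}"

end

theory Submission
  imports Defs
    "HOL-Computational_Algebra.Primes"
    "HOL-Computational_Algebra.Fundamental_Theorem_Algebra"
begin

text \<open>
  A point \<open>(x, y)\<close> is invisible iff \<open>P(x)\<close> divides \<open>y P(s)\<close> for some integer \<open>s\<close> with \<open>0 < s < x\<close>.
  Let \<open>k / m\<close> be \<open>P(s) / P(x)\<close> in lowest terms. Then \<open>m\<close> divides both \<open>P(x)\<close> and \<open>y\<close>, and
  \<open>(x, s)\<close> is an integral point of the curve \<open>m P(s) = k P(x)\<close> with \<open>0 < k < m\<close>. For given \<open>x\<close>
  and \<open>m\<close> at most \<open>X / m\<close> values of \<open>y\<close> are possible.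

  Split at \<open>m = X powr (1 / 2)\<close>. For large \<open>m\<close>, the divisor bound leaves \<open>O(X powr \<epsilon>)\<close> values of
  \<open>m\<close> for each \<open>x\<close>, in total \<open>O(X powr (3 / 2 + \<epsilon>))\<close> points. For small \<open>m\<close>, one needs a bound for
  the number of integral points on the curve that is uniform in \<open>k\<close> and \<open>m\<close>
  (\<open>card_curve_abscissae_le\<close>). It rests on the curves being nearly straight: completing the
  \<open>d\<close>-th power in \<open>P\<close> shows that a point with abscissa \<open>x\<close> lies within \<open>O(1 / (r x))\<close> of a fixed line of slope
  \<open>r = (k / m) powr (1 / d)\<close> (\<open>curve_near_line\<close>). Over an interval around \<open>x\<close> of length a small
  multiple of \<open>r x\<close>, the integer determinant testing three points for collinearity is less
  than 1 in absolute value, hence zero, and all the points lie on one line. That line meets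
  the curve at most \<open>d\<close> times: otherwise \<open>P(\<alpha> T + \<beta>) = c P(T)\<close> with \<open>0 < \<bar>\<alpha>\<bar> < 1\<close>, and an affine
  contraction would map the roots of \<open>P\<close> to themselves, although separability and \<open>d \<ge> 2\<close> provide
  two distinct ones (\<open>no_contracting_symmetry\<close>). Since \<open>O((1 + ln X) / r)\<close> such intervals cover
  \<open>[1, X]\<close> and \<open>1 / r \<le> m powr (1 / d)\<close>, summation over \<open>k\<close> and \<open>m\<close> gives the exponent
  \<open>3 / 2 + 1 / (2 d)\<close> up to a logarithm.
\<close>

section \<open>The divisor bound\<close>

lemma card_divisors_mult_le:
  fixes a b :: nat
  assumes "a > 0" "b > 0"
  shows "card {k. k dvd a * b} \<le> card {k. k dvd a} * card {k. k dvd b}"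
proof -
  have "{k. k dvd a * b} \<subseteq> (\<lambda>(u, v). u * v) ` ({k. k dvd a} \<times> {k. k dvd b})"
    by (force dest: division_decomp)
  then have "card {k. k dvd a * b} \<le> card ({k. k dvd a} \<times> {k. k dvd b})"
    using assms by (intro surj_card_le) auto
  then show ?thesis
    by (simp add: card_cartesian_product)
qed

lemma card_divisors_prod_prime_powers_le:
  fixes f :: "nat \<Rightarrow> nat"
  assumes "finite A" "\<And>p. p \<in> A \<Longrightarrow> prime p"
  shows "card {k. k dvd (\<Prod>p\<in>A. p ^ f p)} \<le> (\<Prod>p\<in>A. f p + 1)"
  using assms
proof (induction A rule: finite_induct)
  case (insert p A)
  then have p: "prime p" and pos: "(\<Prod>p\<in>A. p ^ f p) > 0"
    by (auto intro!: prod_pos simp: prime_gt_0_nat)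
  have "{k. k dvd p ^ f p} = (\<lambda>i. p ^ i) ` {..f p}"
    using p by (auto simp: divides_primepow_nat le_imp_power_dvd)
  then have pp: "card {k. k dvd p ^ f p} \<le> f p + 1"
    by (metis card_atMost card_image_le finite_atMost Suc_eq_plus1)
  have "card {k. k dvd (\<Prod>p\<in>insert p A. p ^ f p)}
      \<le> card {k. k dvd p ^ f p} * card {k. k dvd (\<Prod>p\<in>A. p ^ f p)}"
    using insert pos p by (simp add: card_divisors_mult_le prime_gt_0_nat)
  also have "\<dots> \<le> (f p + 1) * (\<Prod>p\<in>A. f p + 1)"
    using insert by (intro mult_le_mono pp) auto
  finally show ?case
    using insert by simp
qed simp

text \<open>
  Compare the divisor count \<open>\<Prod>(a + 1)\<close> with \<open>n powr \<epsilon> = \<Prod>(p powr \<epsilon>) ^ a\<close> prime by prime. A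
  prime \<open>p \<ge> 2 powr (1 / \<epsilon>)\<close> has \<open>p powr \<epsilon> \<ge> 2\<close>, so its factor \<open>a + 1 \<le> 2 ^ a\<close> is absorbed. Each
  smaller prime costs a factor \<open>c\<close> depending only on \<open>\<epsilon>\<close>, and there are at most \<open>B\<close> of those.
\<close>

lemma divisor_bound:
  fixes \<epsilon> :: real
  assumes "\<epsilon> > 0"
  shows "\<exists>C>0. \<forall>n::nat. n > 0 \<longrightarrow> real (card {k. k dvd n}) \<le> C * real n powr \<epsilon>"
proof -
  define B where "B = nat \<lceil>2 powr (1 / \<epsilon>)\<rceil>"
  define c where "c = max 1 (1 / (\<epsilon> * ln 2))"
  have c1: "c \<ge> 1" by (simp add: c_def)
  have large: "real a + 1 \<le> (real p powr \<epsilon>) ^ a" if "p \<ge> B" for p a :: nat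
  proof -
    have "2 powr (1 / \<epsilon>) \<le> real p"
      using that unfolding B_def by linarith
    then have "(2 powr (1 / \<epsilon>)) powr \<epsilon> \<le> real p powr \<epsilon>"
      using assms by (intro powr_mono2) auto
    then have "2 \<le> real p powr \<epsilon>"
      using assms by (simp add: powr_powr)
    then have "2 ^ a \<le> (real p powr \<epsilon>) ^ a"
      by (intro power_mono) auto
    moreover have "real a + 1 \<le> 2 ^ a"
      using Suc_leI[OF less_exp[of a]] by (metis Suc_eq_plus1 add.commute of_nat_Suc of_nat_le_iff of_nat_numeral of_nat_power)
    ultimately show ?thesis by linarith
  qed
  have small: "real a + 1 \<le> c * (real p powr \<epsilon>) ^ a" if "prime p" for p a :: nat
  proof -
    have l: "\<epsilon> * ln 2 > 0" using assms by simp
    have "c * (\<epsilon> * ln 2) \<ge> (1 / (\<epsilon> * ln 2)) * (\<epsilon> * ln 2)"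
      using l unfolding c_def by (intro mult_right_mono) auto
    then have c2: "c * (\<epsilon> * ln 2) \<ge> 1"
      using assms by simp
    have "real a + 1 \<le> real a * (c * (\<epsilon> * ln 2)) + c"
      using mult_left_mono[OF c2, of "real a"] c1 by simp
    also have "\<dots> = c * (1 + real a * (\<epsilon> * ln 2))"
      by (simp add: algebra_simps)
    also have "\<dots> \<le> c * exp (real a * (\<epsilon> * ln 2))"
      using c1 by (intro mult_left_mono exp_ge_add_one_self) auto
    also have "exp (real a * (\<epsilon> * ln 2)) = (2 powr \<epsilon>) ^ a"
      by (simp add: powr_def exp_of_nat_mult)
    also have "c * \<dots> \<le> c * (real p powr \<epsilon>) ^ a"
      using that c1 assms prime_ge_2_nat[OF that]
      by (intro mult_left_mono power_mono powr_mono2) auto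
    finally show ?thesis .
  qed
  show ?thesis
  proof (intro exI[of _ "c ^ B"] conjI allI impI)
    show "c ^ B > 0" using c1 by simp
    fix n :: nat assume n: "n > 0"
    define A where "A = prime_factors n"
    define f where "f p = multiplicity p n" for p
    have A: "finite A" "\<And>p. p \<in> A \<Longrightarrow> prime p"
      by (auto simp: A_def)
    have n_eq: "n = (\<Prod>p\<in>A. p ^ f p)"
      using prod_prime_factors[of n] n by (simp add: A_def f_def)
    have powr_n: "real n powr \<epsilon> = (\<Prod>p\<in>A. (real p powr \<epsilon>) ^ f p)"
    proof -
      have "real n = (\<Prod>p\<in>A. real p ^ f p)"
        by (subst n_eq) simp
      also have "\<dots> powr \<epsilon> = (\<Prod>p\<in>A. (real p ^ f p) powr \<epsilon>)"
        by (simp add: prod_powr_distrib)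
      also have "\<dots> = (\<Prod>p\<in>A. (real p powr \<epsilon>) ^ f p)"
        using A(2) by (intro prod.cong refl) (auto simp: powr_power powr_realpow[symmetric] powr_powr mult.commute prime_gt_0_nat)
      finally show ?thesis .
    qed
    have "real (card {k. k dvd n}) \<le> real (\<Prod>p\<in>A. f p + 1)"
      using card_divisors_prod_prime_powers_le[OF A, of f] n_eq by (metis of_nat_le_iff)
    also have "\<dots> = (\<Prod>p\<in>A. real (f p) + 1)"
      by (simp add: add.commute)
    also have "\<dots> \<le> (\<Prod>p\<in>A. (if p < B then c else 1) * (real p powr \<epsilon>) ^ f p)"
      using A(2) large small by (intro prod_mono) (auto simp: not_less)
    also have "\<dots> = (\<Prod>p\<in>A. if p < B then c else 1) * real n powr \<epsilon>"
      by (simp add: prod.distrib powr_n)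
    also have "(\<Prod>p\<in>A. if p < B then c else 1) = c ^ card (A \<inter> {..<B})"
      using A(1) by (simp add: prod.If_cases lessThan_def)
    also have "\<dots> * real n powr \<epsilon> \<le> c ^ B * real n powr \<epsilon>"
      using c1 card_mono[of "{..<B}" "A \<inter> {..<B}"]
      by (intro mult_right_mono power_increasing) auto
    finally show "real (card {k. k dvd n}) \<le> c ^ B * real n powr \<epsilon>" .
  qed
qed

section \<open>Lines and the curves \<open>P(s) = c P(x)\<close>\<close>

lemma poly_map_poly_of_int:
  "poly (map_poly of_int P :: 'a::{comm_ring_1,ring_char_0} poly) (of_int x) = of_int (poly P x)"
  by (induction P) (simp_all add: map_poly_pCons)

lemma two_roots_if_rsquarefree:
  fixes F :: "complex poly"
  assumes "rsquarefree F" "degree F \<ge> 2"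
  obtains z w where "z \<noteq> w" "poly F z = 0" "poly F w = 0"
proof -
  obtain z where z: "poly F z = 0"
    using fundamental_theorem_of_algebra[of F] assms(2)
    by (auto simp: constant_degree)
  then obtain G where G: "F = [:-z, 1:] * G"
    by (auto simp: poly_eq_0_iff_dvd dvd_def)
  have F0: "F \<noteq> 0" using assms(2) by auto
  then have "G \<noteq> 0" using G by auto
  then have "degree F = 1 + degree G"
    unfolding G by (subst degree_mult_eq) auto
  then obtain w where w: "poly G w = 0"
    using fundamental_theorem_of_algebra[of G] assms(2)
    by (auto simp: constant_degree)
  have "w \<noteq> z"
  proof
    assume "w = z"
    then have "[:-z, 1:] dvd G"
      using w by (simp add: poly_eq_0_iff_dvd)
    then have "[:-z, 1:] ^ 2 dvd F"
      unfolding G power2_eq_square by (rule mult_dvd_mono[OF dvd_refl])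
    then have "order z F \<ge> 2"
      using F0 order_divides by blast
    then show False
      using rsquarefree_root_order[OF assms(1) z F0] by simp
  qed
  then show ?thesis
    using that z w G by (metis poly_mult mult_zero_right)
qed

text \<open>
  Such an identity would make \<open>z \<mapsto> \<beta> + \<alpha> z\<close> map the finite root set of \<open>F\<close> to itself. Applied
  to two distinct roots at minimal distance, it would produce two distinct roots that are
  closer still.
\<close>

lemma no_contracting_symmetry:
  fixes F :: "complex poly"
  assumes "rsquarefree F" "degree F \<ge> 2" "\<alpha> \<noteq> 0" "norm \<alpha> < 1"
  shows "pcompose F [:\<beta>, \<alpha>:] \<noteq> smult c F"
proof
  assume eq: "pcompose F [:\<beta>, \<alpha>:] = smult c F"
  define D where "D = {norm (z - w) | z w. z \<noteq> w \<and> poly F z = 0 \<and> poly F w = 0}"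
  define R where "R = {z. poly F z = 0}"
  have F0: "F \<noteq> 0" using assms(2) by auto
  have "finite R" using F0 by (simp add: R_def poly_roots_finite)
  have "D \<subseteq> (\<lambda>(z, w). norm (z - w)) ` (R \<times> R)"
    by (auto simp: D_def R_def)
  then have finD: "finite D"
    using \<open>finite R\<close> by (meson finite_SigmaI finite_imageI finite_subset)
  obtain z0 w0 where "z0 \<noteq> w0" "poly F z0 = 0" "poly F w0 = 0"
    using two_roots_if_rsquarefree[OF assms(1,2)] .
  then have "D \<noteq> {}"
    by (auto simp: D_def)
  then have "Min D \<in> D" using finD by simp
  then obtain z w where zw: "Min D = norm (z - w)" "z \<noteq> w" "poly F z = 0" "poly F w = 0"
    by (auto simp: D_def)
  have root: "poly F (\<beta> + \<alpha> * u) = 0" if "poly F u = 0" for u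
  proof -
    have "poly (pcompose F [:\<beta>, \<alpha>:]) u = 0" using that eq by simp
    then show ?thesis by (simp add: poly_pcompose mult.commute)
  qed
  have "norm ((\<beta> + \<alpha> * z) - (\<beta> + \<alpha> * w)) \<in> D"
    unfolding D_def
  proof (rule CollectI, rule exI, rule exI, intro conjI)
    show "norm ((\<beta> + \<alpha> * z) - (\<beta> + \<alpha> * w)) = norm ((\<beta> + \<alpha> * z) - (\<beta> + \<alpha> * w))" ..
    show "poly F (\<beta> + \<alpha> * z) = 0" "poly F (\<beta> + \<alpha> * w) = 0"
      using root zw by simp_all
    show "\<beta> + \<alpha> * z \<noteq> \<beta> + \<alpha> * w"
      using zw(2) assms(3) by simp
  qed
  then have "Min D \<le> norm ((\<beta> + \<alpha> * z) - (\<beta> + \<alpha> * w))"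
    using finD by simp
  also have "\<dots> = norm \<alpha> * norm (z - w)"
    by (metis add_diff_cancel_left norm_mult right_diff_distrib)
  also have "\<dots> < norm (z - w)"
    using assms(4) zw(2) by simp
  finally show False using zw(1) by simp
qed

text \<open>
  The shift by \<open>coeff F (d - 1) / d\<close> completes the \<open>d\<close>-th power: it cancels the two leading
  coefficients of \<open>F\<close>. That the error drops by two degrees, not just one, is what puts
  the curves \<open>F(s) = c F(x)\<close> within \<open>O(1/x)\<close> of a line.
\<close>

lemma completed_power_bound:
  fixes F :: "real poly"
  assumes "degree F = d" "d \<ge> 2" "lead_coeff F = 1"
  shows "\<exists>C>0. \<forall>t\<ge>1. \<bar>poly F t - (t + coeff F (d - 1) / real d) ^ d\<bar> \<le> C * t ^ (d - 2)"
proof -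
  define b where "b = coeff F (d - 1) / real d"
  define Q where "Q = F - [:b, 1:] ^ d"
  have cQ: "coeff Q i = coeff F i - real (d choose i) * b ^ (d - i)" if "i \<le> d" for i
    using that unfolding Q_def by (simp add: coeff_linear_poly_power)
  \<comment> \<open>For \<open>d \<ge> 2\<close> the indices above \<open>d - 2\<close> are \<open>d - 1\<close>, where \<open>b\<close> is chosen to make the
    coefficient vanish, then \<open>d\<close>, where both polynomials are monic, and those beyond the degree.\<close>
  have "coeff Q i = 0" if "i > d - 2" for i
  proof -
    have "i > d \<or> i = d \<or> i = d - 1" using that by arith
    then consider "i > d" | "i = d" | "i = d - 1" by blast
    then show ?thesis
    proof cases
      case 1
      then show ?thesis
        using assms(1) degree_linear_power[of b d] by (simp add: Q_def coeff_eq_0)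
    next
      case 3
      have "d choose (d - 1) = d" using assms(2) by (metis Suc_diff_1 binomial_Suc_n not_gr_zero not_numeral_le_zero)
      moreover have "d - (d - 1) = 1" using assms(2) by simp
      ultimately show ?thesis using assms(2) 3 by (simp add: cQ b_def)
    qed (use assms in \<open>auto simp: cQ coeff_eq_0\<close>)
  qed
  then have degQ: "degree Q \<le> d - 2" by (intro degree_le) auto
  define C where "C = 1 + (\<Sum>i\<le>d-2. \<bar>coeff Q i\<bar>)"
  have "C > 0" unfolding C_def by (intro add_pos_nonneg sum_nonneg) auto
  moreover have "\<bar>poly F t - (t + b) ^ d\<bar> \<le> C * t ^ (d - 2)" if t: "t \<ge> 1" for t
  proof -
    have "poly F t - (t + b) ^ d = poly Q t"
      by (simp add: Q_def add.commute)
    also have "\<dots> = (\<Sum>i\<le>d-2. coeff Q i * t ^ i)"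
      unfolding poly_altdef using degQ
      by (intro sum.mono_neutral_left) (auto simp: coeff_eq_0)
    also have "\<bar>\<dots>\<bar> \<le> (\<Sum>i\<le>d-2. \<bar>coeff Q i\<bar> * t ^ (d - 2))"
      using t by (intro order_trans[OF sum_abs] sum_mono)
        (auto simp: abs_mult intro!: mult_left_mono power_increasing)
    also have "\<dots> = (\<Sum>i\<le>d-2. \<bar>coeff Q i\<bar>) * t ^ (d - 2)"
      by (simp add: sum_distrib_right)
    also have "\<dots> \<le> C * t ^ (d - 2)"
      using t by (intro mult_right_mono) (auto simp: C_def)
    finally show ?thesis .
  qed
  ultimately show ?thesis unfolding b_def by blast
qed

lemma abs_diff_mult_max_power_le:
  fixes a b :: real
  assumes "a \<ge> 0" "b \<ge> 0"
  shows "\<bar>a - b\<bar> * max a b ^ n \<le> \<bar>a ^ Suc n - b ^ Suc n\<bar>"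
proof -
  have *: "(a - b) * a ^ n \<le> a ^ Suc n - b ^ Suc n" if "b \<le> a" "b \<ge> 0" for a b :: real
    using that mult_left_mono[OF power_mono[OF that, of n], of b] by (simp add: algebra_simps)
  have **: "b ^ Suc n \<le> a ^ Suc n" if "b \<le> a" "b \<ge> 0" for a b :: real
    using that by (intro power_mono)
  show ?thesis
    using *[of a b] *[of b a] **[of a b] **[of b a] assms
    by (cases "b \<le> a") (auto simp: max_def abs_if not_le)
qed

text \<open>
  Put \<open>v = s + b\<close> and \<open>u = r (x + b)\<close> with the completing shift \<open>b\<close>. Both \<open>v ^ d\<close> and \<open>u ^ d\<close> differ
  from the common value \<open>F(s) = r ^ d F(x)\<close> by \<open>O(w ^ (d - 2))\<close>, where \<open>w = max v u\<close>, whereas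
  \<open>\<bar>v ^ d - u ^ d\<bar> \<ge> \<bar>v - u\<bar> w ^ (d - 1)\<close>. Hence \<open>\<bar>v - u\<bar> = O(1 / w)\<close>, and \<open>w \<ge> r x\<close>. The constant
  does not depend on the slope \<open>r\<close>, so the estimate is uniform in the curve.
\<close>

lemma curve_near_line:
  fixes F :: "real poly"
  assumes "degree F = d" "d \<ge> 2" "lead_coeff F = 1" "coeff F (d - 1) \<ge> 0"
  shows "\<exists>C>0. \<forall>x s r. x \<ge> 1 \<longrightarrow> s \<ge> 1 \<longrightarrow> 0 < r \<longrightarrow> r \<le> 1 \<longrightarrow> poly F s = r ^ d * poly F x \<longrightarrow>
       \<bar>(s + coeff F (d - 1) / real d) - r * (x + coeff F (d - 1) / real d)\<bar> \<le> C / (r * x)"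
proof -
  define b where "b = coeff F (d - 1) / real d"
  have b: "b \<ge> 0" using assms by (simp add: b_def)
  obtain C where C: "C > 0" "\<And>t. t \<ge> 1 \<Longrightarrow> \<bar>poly F t - (t + b) ^ d\<bar> \<le> C * t ^ (d - 2)"
    using completed_power_bound[OF assms(1-3), folded b_def] by blast
  define e where "e = d - 2"
  have e: "d = Suc (Suc e)"
    using assms(2) by (simp add: e_def)
  show ?thesis
  proof (intro exI[of _ "2 * C"] conjI allI impI)
    show "2 * C > 0" using C(1) by simp
    fix x s r :: real
    assume x: "x \<ge> 1" and s: "s \<ge> 1" and l: "0 < r" "r \<le> 1"
      and eq: "poly F s = r ^ d * poly F x"
    define v where "v = s + b"
    define u where "u = r * (x + b)"
    define w where "w = max v u"
    have v0: "v > 0" and u0: "u > 0"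
      using s x b l by (auto simp: v_def u_def intro!: mult_pos_pos)
    have w0: "w > 0" using v0 by (simp add: w_def)
    have 1: "\<bar>poly F s - v ^ d\<bar> \<le> C * w ^ e"
    proof -
      have "\<bar>poly F s - v ^ d\<bar> \<le> C * s ^ e"
        using C(2)[OF s] by (simp add: v_def e)
      also have "\<dots> \<le> C * w ^ e"
        using C(1) s b by (intro mult_left_mono power_mono) (auto simp: w_def v_def)
      finally show ?thesis .
    qed
    have 2: "\<bar>r ^ d * poly F x - u ^ d\<bar> \<le> C * w ^ e"
    proof -
      have "r ^ d * poly F x - u ^ d = r ^ d * (poly F x - (x + b) ^ d)"
        by (simp add: u_def power_mult_distrib right_diff_distrib)
      then have "\<bar>r ^ d * poly F x - u ^ d\<bar> = r ^ d * \<bar>poly F x - (x + b) ^ d\<bar>"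
        using l by (simp add: abs_mult)
      also have "\<dots> \<le> r ^ d * (C * x ^ e)"
        using C(2)[OF x] l by (intro mult_left_mono) (auto simp: e)
      also have "\<dots> = r\<^sup>2 * (C * (r * x) ^ e)"
        by (simp add: e power_mult_distrib power2_eq_square)
      also have "\<dots> \<le> 1 * (C * w ^ e)"
        using C(1) l x b by (intro mult_mono power_mono power_le_one)
          (auto simp: w_def u_def algebra_simps le_max_iff_disj)
      finally show ?thesis by simp
    qed
    have "\<bar>v - u\<bar> * w * w ^ e = \<bar>v - u\<bar> * w ^ Suc e"
      by simp
    also have "\<dots> \<le> \<bar>v ^ d - u ^ d\<bar>"
      unfolding w_def e using v0 u0 by (intro abs_diff_mult_max_power_le) auto
    also have "\<dots> \<le> 2 * C * w ^ e"
      using 1 2 eq by (simp add: abs_if split: if_splits)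
    finally have "\<bar>v - u\<bar> * w \<le> 2 * C"
      using w0 by simp
    moreover have "r * x \<le> w"
      using l b by (simp add: w_def u_def algebra_simps le_max_iff_disj)
    ultimately have "\<bar>v - u\<bar> * (r * x) \<le> 2 * C"
      by (meson abs_ge_zero mult_left_mono order_trans)
    then have "\<bar>v - u\<bar> \<le> 2 * C / (r * x)"
      using l x by (simp add: pos_le_divide_eq)
    then show "\<bar>s + coeff F (d - 1) / real d - r * (x + coeff F (d - 1) / real d)\<bar> \<le> 2 * C / (r * x)"
      by (simp add: v_def u_def b_def)
  qed
qed

text \<open>
  If the line had more than \<open>d\<close> points on the curve, \<open>P(\<alpha> T + \<beta>) = c P(T)\<close> would hold
  identically. Comparing leading coefficients, \<open>\<alpha> ^ d = c\<close>, so that \<open>0 < \<bar>\<alpha>\<bar> < 1\<close>, which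
  separability excludes by \<open>no_contracting_symmetry\<close>.
\<close>

lemma card_line_inter_curve_le:
  fixes P :: "int poly" and \<alpha> \<beta> c :: real
  assumes "separable_poly P" "degree P = d" "d \<ge> 2" "lead_coeff P = 1" "0 < c" "c < 1"
  shows "card {x::real. poly (map_poly of_int P) (\<alpha> * x + \<beta>) = c * poly (map_poly of_int P) x} \<le> d"
    and "finite {x::real. poly (map_poly of_int P) (\<alpha> * x + \<beta>) = c * poly (map_poly of_int P) x}"
proof -
  define F where "F = (map_poly of_int P :: real poly)"
  define G where "G = pcompose F [:\<beta>, \<alpha>:] - smult c F"
  have degF: "degree F = d" and lcF: "lead_coeff F = 1"
    using assms by (simp_all add: F_def degree_map_poly coeff_map_poly)
  have G0: "G \<noteq> 0"
  proof
    assume "G = 0"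
    then have eq: "pcompose F [:\<beta>, \<alpha>:] = smult c F" by (simp add: G_def)
    have "d = d * degree [:\<beta>, \<alpha>:]"
      using arg_cong[OF eq, of degree] assms degF by (simp add: degree_pcompose)
    then have "\<alpha> \<noteq> 0" using assms(3) by auto
    then have "\<alpha> ^ d = c"
      using arg_cong[OF eq, of lead_coeff] degF lcF assms(5) lead_coeff_comp[of "[:\<beta>, \<alpha>:]" F]
      by (simp add: degree_pcompose)
    then have "\<bar>\<alpha>\<bar> ^ d < 1"
      using assms(5,6) by (simp add: power_abs[symmetric])
    then have "\<bar>\<alpha>\<bar> < 1"
      by (metis not_less one_le_power)
    \<comment> \<open>Separability concerns the complex roots, so the identity is carried over to the
      complex numbers.\<close>
    define h where "h = (map_poly complex_of_real)"
    have hF: "h F = map_poly of_int P"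
      unfolding h_def F_def by (subst map_poly_map_poly) (auto simp: o_def)
    have h_simps: "h (pCons a p) = pCons (of_real a) (h p)" "h (p + q) = h p + h q"
      "h (smult a p) = smult (of_real a) (h p)" "h 0 = 0" for a p q
      unfolding h_def by (auto intro!: poly_eqI simp: coeff_map_poly coeff_pCons split: nat.splits)
    have "h (pcompose F [:\<beta>, \<alpha>:]) = pcompose (h F) [:of_real \<beta>, of_real \<alpha>:]"
      by (induction F) (simp_all add: pcompose_pCons h_simps)
    moreover have "h (smult c F) = smult (of_real c) (h F)"
      by (rule h_simps)
    ultimately have "pcompose (h F) [:of_real \<beta>, of_real \<alpha>:] = smult (of_real c) (h F)"
      using eq by simp
    moreover have "degree (h F) \<ge> 2"
      using assms(2,3) unfolding hF by (simp add: degree_map_poly)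
    ultimately show False
      using no_contracting_symmetry[of "h F" "of_real \<alpha>" "of_real \<beta>" "of_real c"]
        assms(1) \<open>\<alpha> \<noteq> 0\<close> \<open>\<bar>\<alpha>\<bar> < 1\<close> unfolding hF separable_poly_def by auto
  qed
  have "degree G \<le> d"
    unfolding G_def using degF degree_pcompose_le[of F "[:\<beta>, \<alpha>:]"]
    by (intro degree_diff_le) (auto simp: degree_pcompose split: if_splits)
  moreover have "{x. poly F (\<alpha> * x + \<beta>) = c * poly F x} = {x. poly G x = 0}"
    by (simp add: G_def poly_pcompose algebra_simps)
  ultimately show "card {x::real. poly (map_poly of_int P) (\<alpha> * x + \<beta>) = c * poly (map_poly of_int P) x} \<le> d"
    "finite {x::real. poly (map_poly of_int P) (\<alpha> * x + \<beta>) = c * poly (map_poly of_int P) x}"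
    using card_poly_roots_bound[OF G0] poly_roots_finite[OF G0] unfolding F_def by auto
qed

section \<open>Integral points on the curves\<close>

text \<open>
  Three points of the curve lie within \<open>\<delta> \<le> C / (r Y)\<close> of one line, measured vertically, and
  their abscissae lie in an interval of length \<open>H = \<eta> r Y\<close>. The integer determinant that
  expresses their collinearity is therefore at most \<open>4 H \<delta> \<le> 4 \<eta> C\<close> in absolute value, which is
  less than 1 for \<open>\<eta> = 1 / (5 C)\<close>. So the determinant vanishes: all the points lie on one line,
  which meets the curve at most \<open>d\<close> times.
\<close>

lemma card_points_in_short_interval:
  fixes P :: "int poly"
  assumes "separable_poly P" "degree P = d" "d \<ge> 2" "lead_coeff P = 1" "coeff P (d - 1) \<ge> 0"
  shows "\<exists>\<eta>>0. \<forall>r Y S. 0 < r \<longrightarrow> r < 1 \<longrightarrow> Y \<ge> 1 \<longrightarrow>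
    (\<forall>x\<in>S. Y \<le> real_of_int x \<and> real_of_int x \<le> Y + \<eta> * r * Y \<and>
        (\<exists>s\<ge>1. real_of_int (poly P s) = r ^ d * real_of_int (poly P x))) \<longrightarrow> card S \<le> d"
proof -
  define F where "F = (map_poly of_int P :: real poly)"
  define b where "b = coeff F (d - 1) / real d"
  have F: "degree F = d" "lead_coeff F = 1" "coeff F (d - 1) \<ge> 0"
    using assms by (simp_all add: F_def degree_map_poly coeff_map_poly)
  obtain C where C: "C > 0"
    and near: "\<And>x s r. x \<ge> 1 \<Longrightarrow> s \<ge> 1 \<Longrightarrow> 0 < r \<Longrightarrow> r \<le> 1 \<Longrightarrow> poly F s = r ^ d * poly F x
      \<Longrightarrow> \<bar>(s + b) - r * (x + b)\<bar> \<le> C / (r * x)"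
    using curve_near_line[OF F(1) assms(3) F(2,3), folded b_def] by blast
  show ?thesis
  proof (intro exI[of _ "1 / (5 * C)"] conjI allI impI)
    show "1 / (5 * C) > 0" using C by simp
    fix r Y :: real and S :: "int set"
    assume r: "0 < r" "r < 1" and Y: "Y \<ge> 1"
      and S: "\<forall>x\<in>S. Y \<le> real_of_int x \<and> real_of_int x \<le> Y + 1 / (5 * C) * r * Y \<and>
        (\<exists>s\<ge>1. real_of_int (poly P s) = r ^ d * real_of_int (poly P x))"
    define H where "H = 1 / (5 * C) * r * Y"
    obtain s where s: "\<And>x. x \<in> S \<Longrightarrow> s x \<ge> 1"
      "\<And>x. x \<in> S \<Longrightarrow> real_of_int (poly P (s x)) = r ^ d * real_of_int (poly P x)"
      using S by metis
    define \<delta> where "\<delta> x = (real_of_int (s x) + b) - r * (real_of_int x + b)" for x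
    have \<delta>: "\<bar>\<delta> x\<bar> \<le> C / (r * Y)" if "x \<in> S" for x
    proof -
      have x: "Y \<le> real_of_int x" using S that by blast
      have "\<bar>\<delta> x\<bar> \<le> C / (r * real_of_int x)"
        unfolding \<delta>_def using x Y r s[OF that]
        by (intro near) (auto simp: F_def poly_map_poly_of_int)
      also have "\<dots> \<le> C / (r * Y)"
        using x Y r C by (intro divide_left_mono mult_left_mono) auto
      finally show ?thesis .
    qed
    have dist: "\<bar>real_of_int x - real_of_int x'\<bar> \<le> H" if "x \<in> S" "x' \<in> S" for x x'
      using S that unfolding H_def by (smt (verit))
    have H\<delta>: "H * (2 * (C / (r * Y))) = 2 / 5"
      using C r Y by (simp add: H_def)
    show "card S \<le> d"
    proof (cases "card S \<le> 1")
      case True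
      then show ?thesis using assms(3) by simp
    next
      case False
      then obtain x1 x2 where x12: "x1 \<in> S" "x2 \<in> S" "x1 \<noteq> x2"
        by (metis card_le_Suc0_iff_eq card.infinite One_nat_def zero_le)
      define \<alpha> where "\<alpha> = real_of_int (s x2 - s x1) / real_of_int (x2 - x1)"
      define \<beta> where "\<beta> = real_of_int (s x1) - \<alpha> * real_of_int x1"
      have line: "real_of_int (s x) = \<alpha> * real_of_int x + \<beta>" if x: "x \<in> S" for x
      proof -
        \<comment> \<open>In \<open>D\<close> the linear part \<open>r (x + b) - b\<close> of \<open>s x\<close> cancels and only the
          deviations \<open>\<delta>\<close> remain.\<close>
        define D where "D = (x2 - x1) * (s x - s x1) - (x - x1) * (s x2 - s x1)"
        have d: "\<bar>\<delta> u - \<delta> x1\<bar> \<le> 2 * (C / (r * Y))" if "u \<in> S" for u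
          using \<delta>[OF that] \<delta>[OF x12(1)] by linarith
        have "real_of_int D = real_of_int (x2 - x1) * (\<delta> x - \<delta> x1) - real_of_int (x - x1) * (\<delta> x2 - \<delta> x1)"
          by (simp add: D_def \<delta>_def algebra_simps)
        also have "\<bar>\<dots>\<bar> \<le> \<bar>real_of_int (x2 - x1)\<bar> * \<bar>\<delta> x - \<delta> x1\<bar> + \<bar>real_of_int (x - x1)\<bar> * \<bar>\<delta> x2 - \<delta> x1\<bar>"
          by (metis abs_mult abs_triangle_ineq4)
        also have "\<dots> \<le> H * (2 * (C / (r * Y))) + H * (2 * (C / (r * Y)))"
          using d[OF x] d[OF x12(2)] dist[OF x12(2,1)] dist[OF x x12(1)]
          by (intro add_mono mult_mono) auto
        also have "\<dots> < 1" unfolding H\<delta> by simp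
        finally have "D = 0" by linarith
        then have "real_of_int (x2 - x1) * real_of_int (s x - s x1) = real_of_int (x - x1) * real_of_int (s x2 - s x1)"
          unfolding D_def by (metis eq_iff_diff_eq_0 of_int_mult)
        then have "real_of_int (s x - s x1) = \<alpha> * real_of_int (x - x1)"
          using x12(3) by (simp add: \<alpha>_def field_simps)
        then show ?thesis by (simp add: \<beta>_def algebra_simps)
      qed
      have rd: "0 < r ^ d" "r ^ d < 1"
        using r assms(3) by (auto simp: power_less_one_iff)
      let ?L = "{x::real. poly F (\<alpha> * x + \<beta>) = r ^ d * poly F x}"
      have "real_of_int ` S \<subseteq> ?L"
        using s(2) line by (auto simp: F_def poly_map_poly_of_int simp flip: line)
      then have "card (real_of_int ` S) \<le> card ?L"
        using card_line_inter_curve_le(2)[OF assms(1-4) rd] unfolding F_def by (intro card_mono)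
      also have "\<dots> \<le> d"
        using card_line_inter_curve_le(1)[OF assms(1-4) rd] unfolding F_def .
      finally show ?thesis
        by (simp add: card_image inj_on_def)
    qed
  qed
qed

definition curve_abscissae :: "int poly \<Rightarrow> int \<Rightarrow> int \<Rightarrow> real \<Rightarrow> int set" where
  "curve_abscissae P k m X =
     {x. 1 \<le> x \<and> of_int x \<le> X \<and> (\<exists>s\<ge>1. m * poly P s = k * poly P x)}"

lemma finite_curve_abscissae: "finite (curve_abscissae P k m X)"
  by (rule finite_subset[of _ "{1..\<lfloor>X\<rfloor>}"]) (auto simp: curve_abscissae_def le_floor_iff)

text \<open>
  The curve follows a line of slope \<open>r = (k / m) powr (1 / d)\<close>. Sorting the abscissae by \<open>\<lfloor>n ln x\<rfloor>\<close> for
  some \<open>n\<close> of order \<open>1 / r\<close> cuts \<open>[1, X]\<close> into \<open>O(n (1 + ln X))\<close> classes, each so short relative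
  to its position that \<open>card_points_in_short_interval\<close> applies. Finally \<open>1 / r \<le> m powr (1 / d)\<close>
  because \<open>k \<ge> 1\<close>; this is the source of the term \<open>1 / (2 d)\<close> in the final exponent.
\<close>

lemma card_curve_abscissae_le:
  fixes P :: "int poly"
  assumes "separable_poly P" "degree P = d" "d \<ge> 2" "lead_coeff P = 1" "coeff P (d - 1) \<ge> 0"
  shows "\<exists>K>0. \<forall>k m X. 0 < k \<longrightarrow> k < m \<longrightarrow> X \<ge> 1 \<longrightarrow>
    real (card (curve_abscissae P k m X)) \<le> K * real_of_int m powr (1 / real d) * (1 + ln X)"
proof -
  obtain \<eta> where \<eta>: "\<eta> > 0"
    and short: "\<And>r Y S. 0 < r \<Longrightarrow> r < 1 \<Longrightarrow> Y \<ge> 1 \<Longrightarrow>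
      (\<forall>x\<in>S. Y \<le> real_of_int x \<and> real_of_int x \<le> Y + \<eta> * r * Y \<and>
        (\<exists>s\<ge>1. real_of_int (poly P s) = r ^ d * real_of_int (poly P x))) \<Longrightarrow> card S \<le> d"
    using card_points_in_short_interval[OF assms] by blast
  show ?thesis
  proof (intro exI[of _ "real d * (2 / \<eta> + 1)"] conjI allI impI)
    show "real d * (2 / \<eta> + 1) > 0" using \<eta> assms(3) by (simp add: add_pos_pos)
    fix k m :: int and X :: real
    assume k: "0 < k" "k < m" and X: "X \<ge> 1"
    define r where "r = (real_of_int k / real_of_int m) powr (1 / real d)"
    have r: "0 < r" "r < 1"
      using k assms(3) powr_less_mono2[of "1 / real d" "real_of_int k / real_of_int m" 1]
      by (auto simp: r_def)
    have rd: "r ^ d = real_of_int k / real_of_int m"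
      using k assms(3) by (simp add: r_def powr_power)
    define n where "n = nat \<lceil>2 / (\<eta> * r)\<rceil>"
    have n0: "2 / (\<eta> * r) > 0" using \<eta> r by simp
    have n: "2 / (\<eta> * r) \<le> real n" "real n \<le> 2 / (\<eta> * r) + 1"
      using n0 unfolding n_def by linarith+
    then have n1: "n \<ge> 1" using n0 by (cases n) auto
    \<comment> \<open>This choice of \<open>n\<close> ensures \<open>exp (1 / n) \<le> 1 + \<eta> r\<close>, the ratio allowed within a class.\<close>
    have step: "1 / real n \<le> 1" "2 / real n \<le> \<eta> * r"
      using n1 n(1) \<eta> r by (auto simp: field_simps)
    define T where "T = curve_abscissae P k m X"
    have finT: "finite T" by (simp add: T_def finite_curve_abscissae)
    define f where "f x = \<lfloor>real n * ln (real_of_int x)\<rfloor>" for x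
    define J where "J = {0..\<lfloor>real n * ln X\<rfloor>}"
    have fib: "card {x \<in> T. f x = j} \<le> d" for j
    proof (cases "{x \<in> T. f x = j} = {}")
      case False
      define Y where "Y = Min {x \<in> T. f x = j}"
      have Y: "Y \<in> T" "f Y = j"
        using Min_in[of "{x \<in> T. f x = j}"] False finT unfolding Y_def by auto
      have Y1: "Y \<ge> 1" using Y(1) by (simp add: T_def curve_abscissae_def)
      show ?thesis
      proof (rule short[OF r, of "real_of_int Y"])
        show "1 \<le> real_of_int Y" using Y1 by simp
        show "\<forall>x\<in>{x \<in> T. f x = j}. real_of_int Y \<le> real_of_int x \<and>
            real_of_int x \<le> real_of_int Y + \<eta> * r * real_of_int Y \<and>
            (\<exists>s\<ge>1. real_of_int (poly P s) = r ^ d * real_of_int (poly P x))"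
        proof
          fix x assume x: "x \<in> {x \<in> T. f x = j}"
          have x1: "x \<ge> 1" using x by (simp add: T_def curve_abscissae_def)
          have "Y \<le> x" using x finT by (simp add: Y_def)
          have "real n * ln (real_of_int x) \<le> real n * ln (real_of_int Y) + 1"
            using x Y(2) unfolding f_def by auto linarith
          then have "ln (real_of_int x) \<le> ln (real_of_int Y) + 1 / real n"
            using n1 by (simp add: field_simps)
          then have "exp (ln (real_of_int x)) \<le> exp (ln (real_of_int Y) + 1 / real n)"
            by simp
          then have "real_of_int x \<le> real_of_int Y * exp (1 / real n)"
            using x1 Y1 by (simp add: exp_add)
          also have "exp (1 / real n) \<le> 1 + 1 / real n + (1 / real n)\<^sup>2"
            using step(1) by (intro exp_bound) auto
          also have "(1 / real n)\<^sup>2 \<le> 1 / real n"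
            unfolding power2_eq_square using step(1) by (intro mult_left_le) auto
          also have "1 + 1 / real n + 1 / real n \<le> 1 + \<eta> * r"
            using step(2) by simp
          finally have "real_of_int x \<le> real_of_int Y * (1 + \<eta> * r)"
            using Y1 by simp
          moreover obtain s where s: "s \<ge> 1" "m * poly P s = k * poly P x"
            using x by (auto simp: T_def curve_abscissae_def)
          then have "real_of_int m * real_of_int (poly P s) = real_of_int k * real_of_int (poly P x)"
            by (metis of_int_mult)
          then have "real_of_int (poly P s) = r ^ d * real_of_int (poly P x)"
            using k by (simp add: rd field_simps)
          ultimately show "real_of_int Y \<le> real_of_int x \<and>
              real_of_int x \<le> real_of_int Y + \<eta> * r * real_of_int Y \<and>
              (\<exists>s\<ge>1. real_of_int (poly P s) = r ^ d * real_of_int (poly P x))"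
            using \<open>Y \<le> x\<close> s(1) by (auto simp: algebra_simps)
        qed
      qed
    qed (metis card.empty zero_le)
    have "T \<subseteq> (\<Union>j\<in>J. {x \<in> T. f x = j})"
    proof
      fix x assume x: "x \<in> T"
      then have "1 \<le> real_of_int x" "real_of_int x \<le> X"
        by (auto simp: T_def curve_abscissae_def)
      then have "f x \<in> J"
        unfolding f_def J_def by (auto intro!: floor_mono mult_left_mono)
      then show "x \<in> (\<Union>j\<in>J. {x \<in> T. f x = j})" using x by blast
    qed
    then have "card T \<le> card (\<Union>j\<in>J. {x \<in> T. f x = j})"
      using finT by (intro card_mono) (auto simp: J_def)
    also have "\<dots> \<le> (\<Sum>j\<in>J. card {x \<in> T. f x = j})"
      by (rule card_UN_le) (simp add: J_def)
    also have "\<dots> \<le> card J * d"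
      using sum_bounded_above[of J "\<lambda>j. card {x \<in> T. f x = j}" d] fib by simp
    finally have cardT: "real (card T) \<le> real (card J) * real d"
      by (metis of_nat_le_iff of_nat_mult)
    have cardJ: "real (card J) \<le> real n * (1 + ln X)"
    proof -
      have "real (card J) \<le> real n * ln X + 1"
        using X unfolding J_def by simp
      also have "\<dots> \<le> real n * (1 + ln X)"
        using n1 by (simp add: algebra_simps)
      finally show ?thesis .
    qed
    have n_le: "real n \<le> (2 / \<eta> + 1) * real_of_int m powr (1 / real d)"
    proof -
      have "1 / r = (real_of_int m / real_of_int k) powr (1 / real d)"
        using k by (simp add: r_def powr_divide)
      also have "\<dots> \<le> real_of_int m powr (1 / real d)"
        using k by (intro powr_mono2) (auto simp: field_simps)
      finally have inv: "1 / r \<le> real_of_int m powr (1 / real d)" .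
      have "real n \<le> (2 / \<eta>) * (1 / r) + 1" using n(2) by simp
      also have "\<dots> \<le> (2 / \<eta>) * (1 / r) + 1 / r"
        using r by simp
      also have "\<dots> = (2 / \<eta> + 1) * (1 / r)" by (simp add: algebra_simps)
      also have "\<dots> \<le> (2 / \<eta> + 1) * real_of_int m powr (1 / real d)"
        using inv \<eta> by (intro mult_left_mono) auto
      finally show ?thesis .
    qed
    have "real (card T) \<le> real d * (real n * (1 + ln X))"
      using mult_right_mono[OF cardJ, of "real d"] cardT by (simp add: mult.commute)
    also have "\<dots> \<le> real d * ((2 / \<eta> + 1) * real_of_int m powr (1 / real d) * (1 + ln X))"
      using n_le X by (intro mult_left_mono mult_right_mono) auto
    finally show "real (card (curve_abscissae P k m X))
        \<le> real d * (2 / \<eta> + 1) * real_of_int m powr (1 / real d) * (1 + ln X)"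
      by (simp add: T_def mult_ac)
  qed
qed

section \<open>Counting invisible points\<close>

lemma poly_strict_mono_int:
  fixes P :: "int poly" and s x :: int
  assumes "\<And>i. coeff P i \<ge> 0" "degree P > 0" "lead_coeff P = 1" "0 \<le> s" "s < x"
  shows "poly P s < poly P x"
  unfolding poly_altdef
proof (rule sum_strict_mono_ex1)
  show "\<forall>i\<in>{..degree P}. coeff P i * s ^ i \<le> coeff P i * x ^ i"
    using assms by (auto intro!: mult_left_mono power_mono)
  show "\<exists>i\<in>{..degree P}. coeff P i * s ^ i < coeff P i * x ^ i"
    using assms by (intro bexI[of _ "degree P"]) (auto intro!: power_strict_mono)
qed simp

lemma poly_le_sum_coeffs_power:
  fixes P :: "int poly" and x :: int
  assumes "\<And>i. coeff P i \<ge> 0" "x \<ge> 1"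
  shows "poly P x \<le> poly P 1 * x ^ degree P"
proof -
  have "poly P x \<le> (\<Sum>i\<le>degree P. coeff P i * x ^ degree P)"
    unfolding poly_altdef using assms
    by (intro sum_mono mult_left_mono power_increasing) auto
  then show ?thesis by (simp add: poly_altdef sum_distrib_right)
qed

text \<open>
  The first coordinate of the curve is its parameter, so only integral parameters \<open>s\<close> can
  reach a lattice point; the second coordinate there is \<open>y P(s) / P(x)\<close>.
\<close>

lemma not_globally_visible_imp_dvd:
  fixes P :: "int poly"
  assumes "\<not> globally_visible P (x, y)" "poly P x > 0"
  obtains s where "1 \<le> s" "s < x" "poly P x dvd y * poly P s"
proof -
  obtain t :: real where t: "0 < t" "t < of_int x"
    "phi P (of_int y / of_int (poly P x)) t \<in> \<int> \<times> \<int>"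
    using assms by (auto simp: globally_visible_def)
  then obtain s where s: "t = of_int s"
    by (auto simp: phi_def elim: Ints_cases)
  obtain z where "real_of_int y / real_of_int (poly P x) * real_of_int (poly P s) = of_int z"
    using t(3) by (auto simp: phi_def s poly_map_poly_of_int of_rat_divide elim!: Ints_cases)
  then have "real_of_int (y * poly P s) = real_of_int (z * poly P x)"
    using assms(2) by (simp add: field_simps)
  then have "y * poly P s = z * poly P x"
    by (simp only: of_int_eq_iff)
  then show ?thesis
    using that[of s] t(1,2) s by simp
qed

text \<open>
  Take \<open>k / m\<close> to be \<open>P(s) / P(x)\<close> in lowest terms, where \<open>s\<close> is a parameter that hides
  the point; \<open>k < m\<close> because \<open>P\<close> increases.
\<close>

lemma invisible_point_reduced_fraction:
  fixes P :: "int poly"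
  assumes "\<And>i. coeff P i \<ge> 0" "degree P > 0" "lead_coeff P = 1" "coeff P 0 = 0"
    and "(x, y) \<in> invisible_points P X"
  obtains m k where "0 < k" "k < m" "m dvd y" "m dvd poly P x" "x \<in> curve_abscissae P k m X"
proof -
  have xy: "1 \<le> x" "real_of_int x \<le> X" "\<not> globally_visible P (x, y)"
    using assms(5) by (auto simp: invisible_points_def lattice_square_def)
  have pos: "poly P u > 0" if "u \<ge> 1" for u
    using poly_strict_mono_int[OF assms(1-3), of 0 u] that assms(4) by (simp add: poly_0_coeff_0)
  obtain s where s: "1 \<le> s" "s < x" "poly P x dvd y * poly P s"
    using not_globally_visible_imp_dvd[OF xy(3) pos[OF xy(1)]] .
  define g where "g = gcd (poly P x) (poly P s)"
  have g: "g > 0" using pos[OF xy(1)] by (simp add: g_def)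
  obtain m where m: "poly P x = g * m" unfolding g_def by (metis dvdE gcd_dvd1)
  obtain k where k: "poly P s = g * k" unfolding g_def by (metis dvdE gcd_dvd2)
  have "coprime m k"
  proof -
    have "g * gcd m k = g"
      using g m k by (metis abs_of_pos g_def gcd_mult_distrib_int)
    then show ?thesis using g by (simp add: coprime_iff_gcd_eq_1)
  qed
  show ?thesis
  proof (rule that)
    show "0 < k" using pos[OF s(1)] g k by (simp add: zero_less_mult_iff)
    show "k < m" using poly_strict_mono_int[OF assms(1-3), of s x] s g m k by simp
    have "m dvd y * k" using s(3) g by (simp add: m k mult.left_commute)
    then show "m dvd y" using \<open>coprime m k\<close> by (simp add: coprime_dvd_mult_left_iff)
    show "m dvd poly P x" by (simp add: m)
    show "x \<in> curve_abscissae P k m X"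
      using xy s m k by (auto simp: curve_abscissae_def intro!: exI[of _ s])
  qed
qed

lemma card_multiples_le:
  fixes m :: int and X :: real
  assumes "m > 0" "X \<ge> 0"
  shows "real (card {y. 1 \<le> y \<and> of_int y \<le> X \<and> m dvd y}) \<le> X / of_int m"
    and "finite {y. 1 \<le> y \<and> of_int y \<le> X \<and> m dvd y}"
proof -
  let ?S = "{y. 1 \<le> y \<and> of_int y \<le> X \<and> m dvd y}"
  have sub: "?S \<subseteq> (\<lambda>j. m * j) ` {1..\<lfloor>X / of_int m\<rfloor>}"
  proof
    fix y assume y: "y \<in> ?S"
    then obtain j where j: "y = m * j" by auto
    have "j \<ge> 1" using y j assms(1) by (simp add: zero_less_mult_iff int_one_le_iff_zero_less)
    moreover have "of_int j \<le> X / of_int m"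
      using y j assms(1) by (simp add: field_simps)
    ultimately show "y \<in> (\<lambda>j. m * j) ` {1..\<lfloor>X / of_int m\<rfloor>}"
      using j by (auto simp: le_floor_iff)
  qed
  then show "finite ?S" by (rule finite_subset) simp
  have "card ?S \<le> card {1..\<lfloor>X / of_int m\<rfloor>}"
    using sub by (intro surj_card_le) auto
  then have "real (card ?S) \<le> real (nat \<lfloor>X / of_int m\<rfloor>)"
    by simp
  also have "\<dots> \<le> X / of_int m" using assms by (intro of_nat_floor) simp
  finally show "real (card ?S) \<le> X / of_int m" .
qed

lemma card_int_divisors_le:
  fixes N :: int
  assumes "N > 0"
  shows "card {m. 0 < m \<and> m dvd N} \<le> card {k. k dvd nat N}"
    and "finite {m. 0 < m \<and> m dvd N}"
proof -
  show "finite {m. 0 < m \<and> m dvd N}"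
    by (rule finite_subset[of _ "{1..N}"]) (use assms zdvd_imp_le in auto)
  show "card {m. 0 < m \<and> m dvd N} \<le> card {k. k dvd nat N}"
  proof (rule card_inj_on_le[of nat])
    show "inj_on nat {m. 0 < m \<and> m dvd N}"
      by (rule inj_onI) auto
    show "nat ` {m. 0 < m \<and> m dvd N} \<subseteq> {k. k dvd nat N}"
      using assms by (auto simp: nat_dvd_iff)
    show "finite {k. k dvd nat N}"
      using assms by (intro finite_divisors_nat) simp
  qed
qed

lemma real_card_UN_le:
  assumes "finite I"
  shows "real (card (\<Union>i\<in>I. A i)) \<le> (\<Sum>i\<in>I. real (card (A i)))"
  unfolding of_nat_sum[symmetric] by (intro of_nat_mono card_UN_le assms)

text \<open>
  Every invisible point is recorded by the denominator \<open>m\<close> of its reduced fraction, and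
  \<open>m\<close> divides \<open>y\<close>, so each admissible pair of \<open>x\<close> and \<open>m\<close> accounts for at most \<open>X / m\<close> points. The
  points with \<open>m > M\<close> form a subset of \<open>A\<close>, bounded through the number of divisors \<open>m\<close> of \<open>P(x)\<close>.
  Those with \<open>m \<le> M\<close> lie in \<open>B\<close>, bounded through the curves: each \<open>m\<close> has fewer than \<open>m\<close>
  numerators \<open>k\<close>, which cancels the \<open>m\<close> in \<open>X / m\<close>.
\<close>

lemma card_invisible_points_le:
  fixes P :: "int poly" and X M T L :: real
  assumes P: "\<And>i. coeff P i \<ge> 0" "degree P > 0" "lead_coeff P = 1" "coeff P 0 = 0"
    and X: "X \<ge> 1" and M: "M > 0"
    and T: "\<And>x. 1 \<le> x \<Longrightarrow> of_int x \<le> X \<Longrightarrow> real (card {m. 0 < m \<and> m dvd poly P x}) \<le> T"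
    and L: "\<And>k m. 0 < k \<Longrightarrow> k < m \<Longrightarrow> of_int m \<le> M \<Longrightarrow> real (card (curve_abscissae P k m X)) \<le> L"
    and L0: "L \<ge> 0"
  shows "real (card (invisible_points P X)) \<le> X * T * (X / M) + M * L * X"
proof -
  define mult where "mult m = {y::int. 1 \<le> y \<and> of_int y \<le> X \<and> m dvd y}" for m
  define I where "I = {1..\<lfloor>X\<rfloor>}"
  define D where "D x = {m. 0 < m \<and> m dvd poly P x} \<inter> {m. M < of_int m}" for x
  define A where "A = (\<Union>x\<in>I. \<Union>m\<in>D x. {x} \<times> mult m)"
  define B where "B = (\<Union>m\<in>{1..\<lfloor>M\<rfloor>}. \<Union>k\<in>{1..<m}. curve_abscissae P k m X \<times> mult m)"
  have pos: "poly P x > 0" if "x \<in> I" for x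
    using poly_strict_mono_int[OF P(1-3), of 0 x] that P(4) by (simp add: poly_0_coeff_0 I_def)
  have finD: "finite (D x)" and cardD: "real (card (D x)) \<le> T" if "x \<in> I" for x
  proof -
    note fin = card_int_divisors_le(2)[OF pos[OF that]]
    show "finite (D x)" using fin by (simp add: D_def)
    have "real (card (D x)) \<le> real (card {m. 0 < m \<and> m dvd poly P x})"
      using fin by (auto simp: D_def intro!: card_mono)
    also have "\<dots> \<le> T" using that by (intro T) (auto simp: I_def le_floor_iff)
    finally show "real (card (D x)) \<le> T" .
  qed
  have finmult: "finite (mult m)" if "m > 0" for m
    using card_multiples_le(2)[OF that] X unfolding mult_def by simp
  have cardmult: "real (card (mult m)) \<le> X / of_int m" if "m > 0" for m
    using card_multiples_le(1)[OF that] X unfolding mult_def by simp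
  have "invisible_points P X \<subseteq> A \<union> B"
  proof
    fix p assume p: "p \<in> invisible_points P X"
    obtain x y where xy: "p = (x, y)" by (cases p)
    have box: "x \<in> I" "1 \<le> y" "of_int y \<le> X"
      using p by (auto simp: xy I_def invisible_points_def lattice_square_def le_floor_iff)
    obtain m k where mk: "0 < k" "k < m" "m dvd y" "m dvd poly P x" "x \<in> curve_abscissae P k m X"
      using invisible_point_reduced_fraction[OF P p[unfolded xy]] by blast
    show "p \<in> A \<union> B"
    proof (cases "M < of_int m")
      case True
      then show ?thesis using box mk by (auto simp: xy A_def D_def mult_def)
    next
      case False
      then have "m \<in> {1..\<lfloor>M\<rfloor>}" "k \<in> {1..<m}" using mk by (auto simp: le_floor_iff)
      then show ?thesis using box mk by (fastforce simp: xy B_def mult_def)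
    qed
  qed
  moreover have finA: "finite A"
    unfolding A_def using finD finmult by (intro finite_UN_I) (auto simp: I_def D_def)
  moreover have finB: "finite B"
    unfolding B_def using finmult by (auto intro!: finite_UN_I finite_curve_abscissae)
  ultimately have "card (invisible_points P X) \<le> card (A \<union> B)"
    by (intro card_mono) auto
  also have "\<dots> \<le> card A + card B" by (rule card_Un_le)
  finally have "real (card (invisible_points P X)) \<le> real (card A) + real (card B)"
    by linarith
  also have "real (card A) \<le> X * T * (X / M)"
  proof -
    have "real (card A) \<le> (\<Sum>x\<in>I. real (card (\<Union>m\<in>D x. {x} \<times> mult m)))"
      unfolding A_def by (rule real_card_UN_le) (simp add: I_def)
    also have "\<dots> \<le> (\<Sum>x\<in>I. T * (X / M))"
    proof (rule sum_mono)
      fix x assume x: "x \<in> I"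
      have "real (card (\<Union>m\<in>D x. {x} \<times> mult m)) \<le> (\<Sum>m\<in>D x. real (card ({x} \<times> mult m)))"
        by (rule real_card_UN_le[OF finD[OF x]])
      also have "\<dots> \<le> (\<Sum>m\<in>D x. X / M)"
      proof (rule sum_mono)
        fix m assume m: "m \<in> D x"
        have "real (card ({x} \<times> mult m)) \<le> X / of_int m"
          using cardmult[of m] m by (simp add: D_def card_cartesian_product)
        also have "\<dots> \<le> X / M"
          using m M X by (intro divide_left_mono) (auto simp: D_def)
        finally show "real (card ({x} \<times> mult m)) \<le> X / M" .
      qed
      also have "\<dots> = real (card (D x)) * (X / M)" by simp
      also have "\<dots> \<le> T * (X / M)"
        using cardD[OF x] X M by (intro mult_right_mono) auto
      finally show "real (card (\<Union>m\<in>D x. {x} \<times> mult m)) \<le> T * (X / M)" .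
    qed
    also have "\<dots> = real (nat \<lfloor>X\<rfloor>) * (T * (X / M))" by (simp add: I_def)
    also have "\<dots> \<le> X * (T * (X / M))"
    proof (rule mult_right_mono)
      show "real (nat \<lfloor>X\<rfloor>) \<le> X" using X by (intro of_nat_floor) simp
      have "T \<ge> 0" using order_trans[OF of_nat_0_le_iff cardD[of 1]] X by (simp add: I_def)
      then show "0 \<le> T * (X / M)" using X M by simp
    qed
    finally show ?thesis by (simp add: mult.assoc)
  qed
  also have "real (card B) \<le> M * L * X"
  proof -
    have "real (card B) \<le> (\<Sum>m\<in>{1..\<lfloor>M\<rfloor>}. real (card (\<Union>k\<in>{1..<m}. curve_abscissae P k m X \<times> mult m)))"
      unfolding B_def by (rule real_card_UN_le) simp
    also have "\<dots> \<le> (\<Sum>m\<in>{1..\<lfloor>M\<rfloor>}. L * X)"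
    proof (rule sum_mono)
      fix m assume m: "m \<in> {1..\<lfloor>M\<rfloor>}"
      have "real (card (\<Union>k\<in>{1..<m}. curve_abscissae P k m X \<times> mult m))
          \<le> (\<Sum>k\<in>{1..<m}. real (card (curve_abscissae P k m X \<times> mult m)))"
        by (rule real_card_UN_le) simp
      also have "\<dots> \<le> (\<Sum>k\<in>{1..<m}. L * (X / of_int m))"
      proof (rule sum_mono)
        fix k assume k: "k \<in> {1..<m}"
        show "real (card (curve_abscissae P k m X \<times> mult m)) \<le> L * (X / of_int m)"
          unfolding card_cartesian_product of_nat_mult using k m L0
          by (intro mult_mono L cardmult) (auto simp: le_floor_iff)
      qed
      also have "\<dots> \<le> of_int m * (L * (X / of_int m))"
        unfolding sum_constant using m L0 X by (intro mult_right_mono) auto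
      also have "\<dots> = L * X" using m by simp
      finally show "real (card (\<Union>k\<in>{1..<m}. curve_abscissae P k m X \<times> mult m)) \<le> L * X" .
    qed
    also have "\<dots> = real (nat \<lfloor>M\<rfloor>) * (L * X)" by simp
    also have "\<dots> \<le> M * (L * X)"
      using M L0 X by (intro mult_right_mono of_nat_floor) auto
    finally show ?thesis by (simp add: mult.assoc)
  qed
  finally show ?thesis by simp
qed

text \<open>
  With the cut-off \<open>M = X powr (1 / 2)\<close>, the large denominators contribute \<open>X powr (3 / 2 + \<epsilon>)\<close>
  and the small ones at most \<open>M X M powr (1 / d) (1 + ln X)\<close>.
\<close>

lemma card_invisible_points_bound:
  fixes P :: "int poly" and d :: nat and \<epsilon> :: real
  assumes "degree P = d" and "d \<ge> 2"
    and "lead_coeff P = 1" and "coeff P 0 = 0"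
    and "\<And>i. coeff P i \<ge> 0"
    and "separable_poly P" and "\<epsilon> > 0"
  shows "\<exists>C>0. \<forall>X\<ge>1. real (card (invisible_points P X)) \<le> C * X powr (3 / 2 + 1 / (2 * real d) + \<epsilon>)"
proof -
  obtain K where K: "K > 0" and curve: "\<And>k m X. 0 < k \<Longrightarrow> k < m \<Longrightarrow> X \<ge> 1 \<Longrightarrow>
      real (card (curve_abscissae P k m X)) \<le> K * real_of_int m powr (1 / real d) * (1 + ln X)"
    using card_curve_abscissae_le[OF assms(6,1,2,3,5)] by blast
  have \<epsilon>': "\<epsilon> / real d > 0" using assms(2,7) by simp
  \<comment> \<open>\<open>P(x)\<close> has size \<open>X ^ d\<close>, so the exponent \<open>\<epsilon> / d\<close> yields \<open>X powr \<epsilon>\<close> divisors.\<close>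
  obtain C0 where C0: "C0 > 0"
    and div: "\<And>n::nat. n > 0 \<Longrightarrow> real (card {k. k dvd n}) \<le> C0 * real n powr (\<epsilon> / real d)"
    using divisor_bound[OF \<epsilon>'] by blast
  define c1 where "c1 = real_of_int (poly P 1)"
  have pos: "poly P x > 0" if "x \<ge> 1" for x
    using poly_strict_mono_int[OF assms(5) _ assms(3), of 0 x] that assms(1,2,4)
    by (simp add: poly_0_coeff_0)
  have c1: "c1 > 0" using pos[of 1] by (simp add: c1_def)
  define CT where "CT = C0 * c1 powr (\<epsilon> / real d)"
  define C where "C = CT + K * (1 + 1 / \<epsilon>)"
  have CT: "CT > 0" using C0 c1 by (simp add: CT_def)
  show ?thesis
  proof (intro exI[of _ C] conjI allI impI)
    show "C > 0" using CT K assms(7) by (simp add: C_def add_pos_pos)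
    fix X :: real assume X: "X \<ge> 1"
    define M where "M = X powr (1 / 2)"
    define T where "T = CT * X powr \<epsilon>"
    define L where "L = K * M powr (1 / real d) * (1 + ln X)"
    have L0: "L \<ge> 0" using K X by (simp add: L_def)
    have bT: "real (card {m. 0 < m \<and> m dvd poly P x}) \<le> T" if x: "1 \<le> x" "of_int x \<le> X" for x
    proof -
      have p: "real (nat (poly P x)) = real_of_int (poly P x)" using pos[OF x(1)] by simp
      have "real_of_int (poly P x) \<le> c1 * real_of_int x ^ d"
        using poly_le_sum_coeffs_power[OF assms(5) x(1)] assms(1) unfolding c1_def
        by (metis of_int_le_iff of_int_mult of_int_power)
      also have "\<dots> \<le> c1 * X ^ d"
        using c1 x by (intro mult_left_mono power_mono) auto
      finally have le: "real_of_int (poly P x) \<le> c1 * X ^ d" .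
      have "real (card {m. 0 < m \<and> m dvd poly P x}) \<le> C0 * real_of_int (poly P x) powr (\<epsilon> / real d)"
        using div[of "nat (poly P x)"] card_int_divisors_le(1)[OF pos[OF x(1)]] pos[OF x(1)] p by simp
      also have "\<dots> \<le> C0 * (c1 * X ^ d) powr (\<epsilon> / real d)"
        using le pos[OF x(1)] C0 \<epsilon>' by (intro mult_left_mono powr_mono2) auto
      also have "(c1 * X ^ d) powr (\<epsilon> / real d) = c1 powr (\<epsilon> / real d) * X powr \<epsilon>"
        using X c1 assms(2) by (simp add: powr_mult powr_powr flip: powr_realpow)
      finally show ?thesis by (simp add: T_def CT_def)
    qed
    have bL: "real (card (curve_abscissae P k m X)) \<le> L" if "0 < k" "k < m" "of_int m \<le> M" for k m
    proof -
      have "real (card (curve_abscissae P k m X)) \<le> K * real_of_int m powr (1 / real d) * (1 + ln X)"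
        using curve that X by blast
      also have "\<dots> \<le> L"
        unfolding L_def using that K X
        by (intro mult_right_mono mult_left_mono powr_mono2) auto
      finally show ?thesis .
    qed
    have "real (card (invisible_points P X)) \<le> X * T * (X / M) + M * L * X"
      using assms(1-4) X bT bL L0
      by (intro card_invisible_points_le[OF assms(5)]) (auto simp: M_def)
    also have "X * T * (X / M) = CT * X powr (3 / 2 + \<epsilon>)"
    proof -
      have "X * (X / M) = X powr (3 / 2)"
        using X powr_add[of X "3/2" "1/2"] by (simp add: M_def field_simps power2_eq_square)
      moreover have "X * T * (X / M) = CT * (X powr \<epsilon> * (X * (X / M)))"
        by (simp add: T_def)
      ultimately show ?thesis by (simp only: powr_add mult.commute)
    qed
    also have "\<dots> \<le> CT * X powr (3 / 2 + 1 / (2 * real d) + \<epsilon>)"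
      using CT X by (intro mult_left_mono powr_mono) auto
    also have "M * L * X \<le> K * (1 + 1 / \<epsilon>) * X powr (3 / 2 + 1 / (2 * real d) + \<epsilon>)"
    proof -
      have "1 + ln X \<le> X powr \<epsilon> + X powr \<epsilon> / \<epsilon>"
        using ln_powr_bound[OF X assms(7)] ge_one_powr_ge_zero[OF X, of \<epsilon>] assms(7) by simp
      then have ln: "1 + ln X \<le> (1 + 1 / \<epsilon>) * X powr \<epsilon>"
        by (simp add: algebra_simps)
      have "M * X * M powr (1 / real d) = X powr (1 / 2) * X powr 1 * X powr (1 / (2 * real d))"
        using X by (simp add: M_def powr_powr)
      also have "\<dots> = X powr (3 / 2 + 1 / (2 * real d))"
        unfolding powr_add[symmetric] by simp
      finally have e: "M * X * M powr (1 / real d) = X powr (3 / 2 + 1 / (2 * real d))" .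
      have "M * L * X = K * (M * X * M powr (1 / real d)) * (1 + ln X)"
        by (simp add: L_def mult_ac)
      also have "\<dots> \<le> K * X powr (3 / 2 + 1 / (2 * real d)) * ((1 + 1 / \<epsilon>) * X powr \<epsilon>)"
        unfolding e using K ln by (intro mult_left_mono) auto
      also have "\<dots> = K * (1 + 1 / \<epsilon>) * X powr (3 / 2 + 1 / (2 * real d) + \<epsilon>)"
        by (simp add: powr_add mult_ac)
      finally show ?thesis .
    qed
    finally show "real (card (invisible_points P X)) \<le> C * X powr (3 / 2 + 1 / (2 * real d) + \<epsilon>)"
      by (simp add: C_def distrib_right)
  qed
qed

lemma card_lattice_square_ge:
  assumes "X \<ge> 1"
  shows "real (card (lattice_square X)) \<ge> X\<^sup>2 / 4"
proof -
  have "lattice_square X = {1..\<lfloor>X\<rfloor>} \<times> {1..\<lfloor>X\<rfloor>}"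
    by (auto simp: lattice_square_def le_floor_iff)
  then have "real (card (lattice_square X)) = (of_int \<lfloor>X\<rfloor>)\<^sup>2"
    using assms by (simp add: card_cartesian_product power2_eq_square)
  moreover have "\<lfloor>X\<rfloor> \<ge> 1" using assms by simp
  then have "X / 2 \<le> of_int \<lfloor>X\<rfloor>" using floor_correct[of X] by linarith
  then have "(X / 2)\<^sup>2 \<le> (of_int \<lfloor>X\<rfloor>)\<^sup>2"
    using assms by (intro power_mono) auto
  ultimately show ?thesis by (simp add: power_divide)
qed

theorem theorem1p6:
  fixes P :: "int poly" and d :: nat
  assumes "degree P = d" and "d \<ge> 2"
    and "lead_coeff P = 1" and "coeff P 0 = 0"
    and "\<And>i. coeff P i \<ge> 0"
    and "separable_poly P"
  shows "(\<forall>\<epsilon>::real. \<epsilon> > 0 \<longrightarrow> (\<exists>C::real. \<forall>X::real. X \<ge> 1 \<longrightarrow>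
            real (card (invisible_points P X)) \<le> C * X powr (3 / 2 + 1 / (2 * real d) + \<epsilon>)))
       \<and> (\<forall>\<epsilon>::real. \<epsilon> > 0 \<longrightarrow> (\<exists>C::real. \<forall>X::real. X \<ge> 1 \<longrightarrow>
            real (card (invisible_points P X)) / real (card (lattice_square X))
              \<le> C * X powr (- 1 / 2 + 1 / (2 * real d) + \<epsilon>)))"
proof (intro conjI allI impI)
  fix \<epsilon> :: real assume "\<epsilon> > 0"
  then obtain C where C: "C > 0" "\<And>X. X \<ge> 1 \<Longrightarrow>
      real (card (invisible_points P X)) \<le> C * X powr (3 / 2 + 1 / (2 * real d) + \<epsilon>)"
    using card_invisible_points_bound[OF assms] by blast
  then show "\<exists>C::real. \<forall>X::real. X \<ge> 1 \<longrightarrow>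
      real (card (invisible_points P X)) \<le> C * X powr (3 / 2 + 1 / (2 * real d) + \<epsilon>)"
    by blast
  show "\<exists>C::real. \<forall>X::real. X \<ge> 1 \<longrightarrow>
      real (card (invisible_points P X)) / real (card (lattice_square X))
        \<le> C * X powr (- 1 / 2 + 1 / (2 * real d) + \<epsilon>)"
  proof (intro exI[of _ "4 * C"] allI impI)
    fix X :: real assume X: "X \<ge> 1"
    have "real (card (invisible_points P X)) / real (card (lattice_square X))
        \<le> C * X powr (3 / 2 + 1 / (2 * real d) + \<epsilon>) / (X\<^sup>2 / 4)"
      using C(2)[OF X] C(1) X card_lattice_square_ge[OF X] by (intro frac_le) auto
    also have "\<dots> = 4 * C * (X powr (3 / 2 + 1 / (2 * real d) + \<epsilon>) / X powr 2)"
      using X by (simp add: powr_numeral)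
    also have "\<dots> = 4 * C * X powr (- 1 / 2 + 1 / (2 * real d) + \<epsilon>)"
      by (simp add: algebra_simps flip: powr_diff)
    finally show "real (card (invisible_points P X)) / real (card (lattice_square X))
        \<le> 4 * C * X powr (- 1 / 2 + 1 / (2 * real d) + \<epsilon>)" .
  qed
qed

end
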